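(* Let $K\ge 1$, let $\mathcal{S}_H(K)$ be the class of normalized harmonic $K$-quasiconformal mappings in the unit disk $\mathbb{D}$, and let $\alpha_K$ be its order. If $f\in\mathcal{S}_H(K)$, then: (i) $f$ is in the harmonic Bergman space $a^p$ for all $0<p<1/\alpha_K$; (ii) $f_z,\ \overline{f_{\bar z}}$ belong to the Bergman space $A^q$, and $f_\theta,\ r f_r$ belong to $a^q$, for all $0<q<1/(\alpha_K+1)$.
   Context: $\mathbb{D}$ is the open unit disk in $\mathbb{C}$ and $dA(z)=\frac{1}{\pi}\,dx\,dy$ is the normalized area measure on $\mathbb{D}$. A complex-valued function on $\mathbb{D}$ is harmonic if its real and imaginary parts are harmonic; it has a unique representation $f=h+\overline{g}$ with $h,g$ analytic in $\mathbb{D}$ and $g(0)=0$. Put $\|f\|_p:=\left(\int_{\mathbb{D}}|f(z)|^p\,dA(z)\right)^{1/p}$ for $0<p<\infty$. The Bergman space $A^p$ is the set of analytic $f$ in $\mathbb{D}$ with $\|f\|_p<\infty$; the harmonic Bergman space $a^p$ is the set of complex-valued harmonic $f$ in $\mathbb{D}$ with $\|f\|_p<\infty$. For $K\ge 1$, a sense-preserving harmonic function $f=h+\overline{g}$ in $\mathbb{D}$ is called $K$-quasiregular if $D_f:=\frac{|f_z|+|f_{\bar z}|}{|f_z|-|f_{\bar z}|}\le K$ throughout $\mathbb{D}$; equivalently, $\omega:=g'/h'$ satisfies $|\omega(z)|\le k:=\frac{K-1}{K+1}<1$ for all $z\in\mathbb{D}$. It is called $K$-quasiconformal if it is $K$-quasiregular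 and homeomorphic in $\mathbb{D}$ (a homeomorphism onto its image). $\mathcal{S}_H$ is the class of all sense-preserving univalent (injective) harmonic functions $f=h+\overline{g}$ in $\mathbb{D}$ with $h(0)=g(0)=h'(0)-1=0$, and $\mathcal{S}_H(K):=\{f=h+\overline{g}\in\mathcal{S}_H: f\text{ is }K\text{-quasiconformal}\}$. The order of $\mathcal{S}_H(K)$ is $\alpha_K:=\sup_{f\in\mathcal{S}_H(K)}\left|\frac{h''(0)}{2}\right|$. For $z=re^{i\theta}\in\mathbb{D}$, $f_\theta$ and $f_r$ denote the partial derivatives of $f(re^{i\theta})$ with respect to $\theta$ and $r$, and $f_z$, $f_{\bar z}$ are the Wirtinger derivatives, so that $f_z=h'$ and $\overline{f_{\bar z}}=g'$. *)

theory Defs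
  imports "HOL-Analysis.Analysis"
begin

text \<open>
  Functions on the unit disk are functions on all of \<^typ>\<open>complex\<close>, of which only the values on
  the open disk matter; every notion below depends only on these values.
\<close>

abbreviation disk :: "complex set" where
  "disk \<equiv> ball 0 1"

definition deriv_x :: "(complex \<Rightarrow> 'a::real_normed_vector) \<Rightarrow> complex \<Rightarrow> 'a" where
  "deriv_x u z = vector_derivative (\<lambda>t::real. u (z + of_real t)) (at 0)"

definition deriv_y :: "(complex \<Rightarrow> 'a::real_normed_vector) \<Rightarrow> complex \<Rightarrow> 'a" where
  "deriv_y u z = vector_derivative (\<lambda>t::real. u (z + \<i> * of_real t)) (at 0)"

definition C1_on :: "complex set \<Rightarrow> (complex \<Rightarrow> 'a::real_normed_vector) \<Rightarrow> bool" where
  "C1_on S u \<longleftrightarrow>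
     (\<forall>z\<in>S. (\<lambda>t::real. u (z + of_real t)) differentiable (at 0) \<and>
            (\<lambda>t::real. u (z + \<i> * of_real t)) differentiable (at 0)) \<and>
     continuous_on S (deriv_x u) \<and> continuous_on S (deriv_y u)"

definition C2_on :: "complex set \<Rightarrow> (complex \<Rightarrow> 'a::real_normed_vector) \<Rightarrow> bool" where
  "C2_on S u \<longleftrightarrow> C1_on S u \<and> C1_on S (deriv_x u) \<and> C1_on S (deriv_y u)"

definition real_harmonic_on :: "complex set \<Rightarrow> (complex \<Rightarrow> real) \<Rightarrow> bool" where
  "real_harmonic_on S u \<longleftrightarrow>
     C2_on S u \<and> (\<forall>z\<in>S. deriv_x (deriv_x u) z + deriv_y (deriv_y u) z = 0)"

definition harmonic_on :: "complex set \<Rightarrow> (complex \<Rightarrow> complex) \<Rightarrow> bool" where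
  "harmonic_on S f \<longleftrightarrow>
     real_harmonic_on S (\<lambda>z. Re (f z)) \<and> real_harmonic_on S (\<lambda>z. Im (f z))"

definition canonical_rep ::
    "(complex \<Rightarrow> complex) \<Rightarrow> (complex \<Rightarrow> complex) \<Rightarrow> (complex \<Rightarrow> complex) \<Rightarrow> bool" where
  "canonical_rep f h g \<longleftrightarrow>
     h analytic_on disk \<and> g analytic_on disk \<and> g 0 = 0 \<and>
     (\<forall>z\<in>disk. f z = h z + cnj (g z))"

definition deriv_z :: "(complex \<Rightarrow> complex) \<Rightarrow> complex \<Rightarrow> complex" where
  "deriv_z f z = (deriv_x f z - \<i> * deriv_y f z) / 2"

definition deriv_zbar :: "(complex \<Rightarrow> complex) \<Rightarrow> complex \<Rightarrow> complex" where
  "deriv_zbar f z = (deriv_x f z + \<i> * deriv_y f z) / 2"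

text \<open>
  Derivatives of \<open>f (r e\<^sup>i\<^sup>\<theta>)\<close> with respect to \<open>\<theta>\<close> and \<open>r\<close>, at \<open>r = \<bar>z\<bar>\<close> and \<open>\<theta> = Arg z\<close>.
  At the origin \<open>Arg 0 = 0\<close>: there \<open>deriv_theta f 0 = 0\<close>, and \<open>deriv_r f 0\<close> is the
  derivative along the positive real axis, which disappears in \<open>r f\<^sub>r\<close>.
\<close>

definition deriv_theta :: "(complex \<Rightarrow> complex) \<Rightarrow> complex \<Rightarrow> complex" where
  "deriv_theta f z = vector_derivative (\<lambda>\<theta>. f (rcis (cmod z) \<theta>)) (at (Arg z))"

definition deriv_r :: "(complex \<Rightarrow> complex) \<Rightarrow> complex \<Rightarrow> complex" where
  "deriv_r f z = vector_derivative (\<lambda>r. f (rcis r (Arg z))) (at (cmod z))"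

definition area_measure :: "complex measure" where
  "area_measure = scale_measure (ennreal (1 / pi)) (restrict_space lborel disk)"

definition bergman_norm :: "real \<Rightarrow> (complex \<Rightarrow> complex) \<Rightarrow> ennreal" where
  "bergman_norm p f =
     (let I = (\<integral>\<^sup>+ z. ennreal (cmod (f z) powr p) \<partial>area_measure)
      in if I = \<infinity> then \<infinity> else ennreal (enn2real I powr (1 / p)))"

definition bergman :: "real \<Rightarrow> (complex \<Rightarrow> complex) set" where
  "bergman p = {f. f analytic_on disk \<and> bergman_norm p f < \<infinity>}"

definition harmonic_bergman :: "real \<Rightarrow> (complex \<Rightarrow> complex) set" where
  "harmonic_bergman p = {f. harmonic_on disk f \<and> bergman_norm p f < \<infinity>}"

text \<open>
  Sense-preserving is positivity of the Jacobian \<open>\<bar>f\<^sub>z\<bar>\<^sup>2 - \<bar>f\<^sub>z\<^sub>b\<^sub>a\<^sub>r\<bar>\<^sup>2\<close>; in particular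
  the denominator of the dilatation is positive.
\<close>

definition jacobian :: "(complex \<Rightarrow> complex) \<Rightarrow> complex \<Rightarrow> real" where
  "jacobian f z = (cmod (deriv_z f z))\<^sup>2 - (cmod (deriv_zbar f z))\<^sup>2"

definition sense_preserving_harmonic :: "(complex \<Rightarrow> complex) \<Rightarrow> bool" where
  "sense_preserving_harmonic f \<longleftrightarrow> harmonic_on disk f \<and> (\<forall>z\<in>disk. jacobian f z > 0)"

definition dilatation :: "(complex \<Rightarrow> complex) \<Rightarrow> complex \<Rightarrow> real" where
  "dilatation f z =
     (cmod (deriv_z f z) + cmod (deriv_zbar f z)) / (cmod (deriv_z f z) - cmod (deriv_zbar f z))"

definition harmonic_quasiregular :: "real \<Rightarrow> (complex \<Rightarrow> complex) \<Rightarrow> bool" where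
  "harmonic_quasiregular K f \<longleftrightarrow>
     sense_preserving_harmonic f \<and> (\<forall>z\<in>disk. dilatation f z \<le> K)"

definition harmonic_quasiconformal :: "real \<Rightarrow> (complex \<Rightarrow> complex) \<Rightarrow> bool" where
  "harmonic_quasiconformal K f \<longleftrightarrow>
     harmonic_quasiregular K f \<and> (\<exists>f'. homeomorphism disk (f ` disk) f f')"

definition S_H :: "(complex \<Rightarrow> complex) set" where
  "S_H = {f. sense_preserving_harmonic f \<and> inj_on f disk \<and>
             (\<exists>h g. canonical_rep f h g \<and> h 0 = 0 \<and> g 0 = 0 \<and> deriv h 0 - 1 = 0)}"

definition S_HK :: "real \<Rightarrow> (complex \<Rightarrow> complex) set" where
  "S_HK K = {f \<in> S_H. harmonic_quasiconformal K f}"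

text \<open>
  The supremum is taken in the extended reals, so that no boundedness is presupposed; on the
  disk \<open>h\<close> is determined by \<open>f\<close>.
\<close>

definition order_HK :: "real \<Rightarrow> ereal" where
  "order_HK K =
     Sup {ereal (cmod (deriv (deriv h) 0 / 2)) | f h g. f \<in> S_HK K \<and> canonical_rep f h g}"

end

theory Submission
  imports Defs "HOL-Complex_Analysis.Riemann_Mapping"
begin

text \<open>
  The class is invariant under the Koebe transform
  \<open>F(z) = (f((z + \<zeta>) / (1 + \<zeta>\<^sup>* z)) - f(\<zeta>)) / ((1 - \<bar>\<zeta>\<bar>\<^sup>2) h'(\<zeta>))\<close>, where \<open>\<zeta>\<^sup>*\<close> is the conjugate
  of \<open>\<zeta>\<close>. Comparing the second coefficient of \<open>F\<close> with the order \<open>\<alpha>\<close> gives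
  \<open>\<bar>(1 - \<bar>\<zeta>\<bar>\<^sup>2) h''(\<zeta>) / h'(\<zeta>) - 2 \<zeta>\<^sup>*\<bar> \<le> 2 \<alpha>\<close>; integrating this along a radius gives
  \<open>\<bar>h'(z)\<bar> = O((1 - \<bar>z\<bar>) powr - (\<alpha> + 1))\<close>, and integrating once more, with \<open>\<bar>g'\<bar> < \<bar>h'\<bar>\<close>,
  \<open>\<bar>f(z)\<bar> = O((1 - \<bar>z\<bar>) powr - \<alpha>)\<close> when \<open>\<alpha> > 0\<close>. Everything then follows because
  \<open>(1 - \<bar>z\<bar>) powr - s\<close> is area integrable for \<open>s < 1\<close>.
\<close>

subsection \<open>Wirtinger, angular and radial derivatives\<close>

text \<open>The chain rule along the line \<open>z + c * t\<close>, with \<open>c = 1\<close> and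
  \<open>c = \<i>\<close>, connects the total derivative with the one-dimensional derivatives behind
  \<open>deriv_x\<close> and \<open>deriv_y\<close>.\<close>

lemma has_vector_derivative_partials:
  assumes "(f has_derivative L) (at z)"
  shows "((\<lambda>t::real. f (z + of_real t)) has_vector_derivative L 1) (at 0)"
    and "((\<lambda>t::real. f (z + \<i> * of_real t)) has_vector_derivative L \<i>) (at 0)"
proof -
  interpret L: bounded_linear L using assms by (rule has_derivative_bounded_linear)
  have *: "((\<lambda>t::real. f (z + c * of_real t)) has_vector_derivative L c) (at 0)" for c
  proof -
    have "((\<lambda>t::real. z + c * of_real t) has_derivative (\<lambda>t. c * of_real t)) (at 0)"
      by (auto intro!: derivative_eq_intros)
    from diff_chain_at[OF this, of f L] assms
    have "((\<lambda>t::real. f (z + c * of_real t)) has_derivative (\<lambda>t. L (c * of_real t))) (at 0)"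
      by (simp add: o_def)
    moreover have "L (c * of_real t) = t *\<^sub>R L c" for t
      using L.scaleR[of t c] by (simp add: scaleR_conv_of_real mult.commute)
    ultimately show ?thesis by (simp add: has_vector_derivative_def)
  qed
  from *[of 1] *[of "\<i>"] show "((\<lambda>t::real. f (z + of_real t)) has_vector_derivative L 1) (at 0)"
    and "((\<lambda>t::real. f (z + \<i> * of_real t)) has_vector_derivative L \<i>) (at 0)" by simp_all
qed

lemma has_derivative_imp_partials:
  assumes "(f has_derivative L) (at z)"
  shows "deriv_x f z = L 1" and "deriv_y f z = L \<i>"
  using has_vector_derivative_partials[OF assms]
  by (simp_all add: deriv_x_def deriv_y_def vector_derivative_at)

text \<open>Agreement with \<open>v\<close> is asked on the open set only, because the rule is also
  applied to \<open>deriv_x u\<close> and \<open>deriv_y u\<close>, whose formulas are known only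
  there.\<close>

lemma C1_onI:
  assumes S: "open S" and eq: "\<And>z. z \<in> S \<Longrightarrow> u z = v z"
    and v: "\<And>z. z \<in> S \<Longrightarrow> (v has_derivative L z) (at z)"
    and cont: "continuous_on S (\<lambda>z. L z 1)" "continuous_on S (\<lambda>z. L z \<i>)"
  shows "C1_on S u" and "\<And>z. z \<in> S \<Longrightarrow> deriv_x u z = L z 1" and "\<And>z. z \<in> S \<Longrightarrow> deriv_y u z = L z \<i>"
proof -
  have u: "(u has_derivative L z) (at z)" if "z \<in> S" for z
    using has_derivative_transform_within_open[OF v[OF that] S that] eq by simp
  show x: "\<And>z. z \<in> S \<Longrightarrow> deriv_x u z = L z 1" and y: "\<And>z. z \<in> S \<Longrightarrow> deriv_y u z = L z \<i>"
    using has_derivative_imp_partials[OF u] by simp_all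
  have "continuous_on S (deriv_x u)" "continuous_on S (deriv_y u)"
    using cont x y by (simp_all cong: continuous_on_cong)
  moreover have "(\<lambda>t::real. u (z + of_real t)) differentiable (at 0)"
    "(\<lambda>t::real. u (z + \<i> * of_real t)) differentiable (at 0)" if "z \<in> S" for z
    using has_vector_derivative_partials[OF u[OF that]]
    by (auto simp: differentiable_def has_vector_derivative_def)
  ultimately show "C1_on S u" by (auto simp: C1_on_def)
qed

lemma C1_on_Re_holomorphic:
  assumes S: "open S" and F: "F holomorphic_on S" and eq: "\<And>z. z \<in> S \<Longrightarrow> u z = Re (F z)"
  shows "C1_on S u" and "\<And>z. z \<in> S \<Longrightarrow> deriv_x u z = Re (deriv F z)"
    and "\<And>z. z \<in> S \<Longrightarrow> deriv_y u z = Re (\<i> * deriv F z)"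
proof -
  have d: "((\<lambda>z. Re (F z)) has_derivative (\<lambda>w. Re (deriv F z * w))) (at z)" if "z \<in> S" for z
    using has_derivative_Re[OF holomorphic_derivI[OF F S that, of UNIV, unfolded has_field_derivative_def]] by simp
  have F': "continuous_on S (deriv F)"
    by (intro holomorphic_on_imp_continuous_on holomorphic_deriv F S)
  have c: "continuous_on S (\<lambda>z. Re (deriv F z * w))" for w
    by (intro continuous_intros F')
  note * = C1_onI[OF S eq d c c]
  show "C1_on S u" "\<And>z. z \<in> S \<Longrightarrow> deriv_x u z = Re (deriv F z)"
    "\<And>z. z \<in> S \<Longrightarrow> deriv_y u z = Re (\<i> * deriv F z)"
    using * by (simp_all add: mult.commute)
qed

text \<open>The partials of \<open>Re F\<close> are the real parts of the holomorphic functions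
  \<open>F'\<close> and \<open>\<i> * F'\<close>, so the first-order lemma can be iterated. Two
  derivatives in the y direction bring out \<open>\<i>\<close> twice, and the Laplacian is
  \<open>Re F'' - Re F'' = 0\<close>.\<close>

lemma real_harmonic_on_Re_holomorphic:
  assumes S: "open S" and F: "F holomorphic_on S" and eq: "\<And>z. z \<in> S \<Longrightarrow> u z = Re (F z)"
  shows "real_harmonic_on S u"
proof -
  note 1 = C1_on_Re_holomorphic[OF assms]
  have F': "deriv F holomorphic_on S" by (intro holomorphic_deriv F S)
  note 2 = C1_on_Re_holomorphic[OF S F' 1(2)]
  have iF': "(\<lambda>z. \<i> * deriv F z) holomorphic_on S" by (intro holomorphic_intros F')
  note 3 = C1_on_Re_holomorphic[OF S iF' 1(3)]
  have "deriv (\<lambda>z. \<i> * deriv F z) z = \<i> * deriv (deriv F) z" if "z \<in> S" for z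
    using F' S that by (intro deriv_cmult) (auto simp: holomorphic_on_imp_differentiable_at)
  with 1(1) 2(1,2) 3(1,3) show ?thesis
    by (simp add: real_harmonic_on_def C2_on_def)
qed

lemma harmonic_on_add_cnj:
  assumes S: "open S" and h: "h holomorphic_on S" and g: "g holomorphic_on S"
    and eq: "\<And>z. z \<in> S \<Longrightarrow> f z = h z + cnj (g z)"
  shows "harmonic_on S f"
  unfolding harmonic_on_def
proof
  show "real_harmonic_on S (\<lambda>z. Re (f z))"
    by (rule real_harmonic_on_Re_holomorphic[where F = "\<lambda>z. h z + g z"])
       (auto intro!: S holomorphic_intros h g simp: eq)
  \<comment> \<open>\<open>Im (h + cnj g) = Im (h - g)\<close>, and
    \<open>Im w = Re (- \<i> * w)\<close>.\<close>
  show "real_harmonic_on S (\<lambda>z. Im (f z))"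
    by (rule real_harmonic_on_Re_holomorphic[where F = "\<lambda>z. - \<i> * (h z - g z)"])
       (auto intro!: S holomorphic_intros h g simp: eq)
qed

section \<open>Derivatives of \<open>f\<close> in terms of its analytic parts\<close>

lemma canonical_rep_holomorphic:
  assumes "canonical_rep f h g"
  shows "h holomorphic_on disk" and "g holomorphic_on disk"
    and "z \<in> disk \<Longrightarrow> f z = h z + cnj (g z)" and "continuous_on disk f"
proof -
  show h: "h holomorphic_on disk" and g: "g holomorphic_on disk"
    using assms by (auto simp: canonical_rep_def intro: analytic_imp_holomorphic)
  have "continuous_on disk (\<lambda>z. h z + cnj (g z))"
    using h g by (intro continuous_intros holomorphic_on_imp_continuous_on)
  then show "continuous_on disk f"
    by (rule continuous_on_eq) (use assms in \<open>auto simp: canonical_rep_def\<close>)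
qed (use assms in \<open>auto simp: canonical_rep_def\<close>)

lemma canonical_rep_has_derivative:
  assumes rep: "canonical_rep f h g" and z: "z \<in> disk"
  shows "(f has_derivative (\<lambda>w. deriv h z * w + cnj (deriv g z * w))) (at z)"
proof -
  note hg = canonical_rep_holomorphic[OF rep]
  have "(h has_derivative (\<lambda>w. deriv h z * w)) (at z)" "(g has_derivative (\<lambda>w. deriv g z * w)) (at z)"
    using holomorphic_derivI[OF hg(1) open_ball z, of UNIV] holomorphic_derivI[OF hg(2) open_ball z, of UNIV]
    by (simp_all add: has_field_derivative_def)
  then have "((\<lambda>z. h z + cnj (g z)) has_derivative (\<lambda>w. deriv h z * w + cnj (deriv g z * w))) (at z)"
    by (intro has_derivative_add has_derivative_cnj)
  then show ?thesis
    using has_derivative_transform_within_open[OF _ open_ball z] hg(3) by force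
qed

lemma
  assumes rep: "canonical_rep f h g" and z: "z \<in> disk"
  shows deriv_z_canonical_rep: "deriv_z f z = deriv h z"
    and deriv_zbar_canonical_rep: "deriv_zbar f z = cnj (deriv g z)"
  by (simp_all add: deriv_z_def deriv_zbar_def algebra_simps
      has_derivative_imp_partials[OF canonical_rep_has_derivative[OF assms]])

lemma has_derivative_imp_has_vector_derivative_along:
  assumes "(\<gamma> has_vector_derivative v) (at t)" and "(f has_derivative L) (at (\<gamma> t))"
  shows "((\<lambda>s. f (\<gamma> s)) has_vector_derivative L v) (at t)"
proof -
  interpret L: bounded_linear L using assms(2) by (rule has_derivative_bounded_linear)
  from diff_chain_at[OF assms(1)[unfolded has_vector_derivative_def] assms(2)]
  show ?thesis by (simp add: o_def has_vector_derivative_def L.scaleR)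
qed

text \<open>Both right-hand sides are a holomorphic function plus the conjugate of one, which later
  gives harmonicity. For \<open>deriv_r\<close> the factor \<open>cmod z\<close> is what turns the
  direction \<open>cis (Arg z)\<close> into \<open>z\<close>.\<close>

lemma
  assumes rep: "canonical_rep f h g" and z: "z \<in> disk"
  shows deriv_theta_canonical_rep:
      "deriv_theta f z = \<i> * z * deriv h z + cnj (\<i> * z * deriv g z)"
    and norm_mult_deriv_r_canonical_rep:
      "of_real (cmod z) * deriv_r f z = z * deriv h z + cnj (z * deriv g z)"
proof -
  \<comment> \<open>This holds at the origin too, so that point is covered by the same
    computation.\<close>
  have z_eq: "rcis (cmod z) (Arg z) = z" by (rule rcis_cmod_Arg)
  note f = canonical_rep_has_derivative[OF assms]
  have "((\<lambda>\<theta>. rcis (cmod z) \<theta>) has_vector_derivative \<i> * z) (at (Arg z))"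
  proof -
    have "((\<lambda>\<theta>. of_real (cmod z) * cis \<theta>) has_vector_derivative of_real (cmod z) * (\<i> * cis (Arg z))) (at (Arg z))"
      by (auto simp: has_vector_derivative_complex_iff intro!: derivative_eq_intros)
    then show ?thesis using z_eq by (simp add: rcis_def mult.left_commute)
  qed
  from has_derivative_imp_has_vector_derivative_along[OF this, unfolded z_eq, OF f]
  show "deriv_theta f z = \<i> * z * deriv h z + cnj (\<i> * z * deriv g z)"
    by (simp add: deriv_theta_def vector_derivative_at mult_ac)
  have "((\<lambda>r. rcis r (Arg z)) has_vector_derivative cis (Arg z)) (at (cmod z))"
    unfolding rcis_def
    by (auto intro!: derivative_eq_intros simp: has_vector_derivative_def scaleR_conv_of_real)
  from has_derivative_imp_has_vector_derivative_along[OF this, unfolded z_eq, OF f]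
  have "of_real (cmod z) * deriv_r f z
      = of_real (cmod z) * (deriv h z * cis (Arg z) + cnj (deriv g z * cis (Arg z)))"
    by (simp add: deriv_r_def vector_derivative_at)
  also have "\<dots> = rcis (cmod z) (Arg z) * deriv h z + cnj (rcis (cmod z) (Arg z) * deriv g z)"
    by (simp add: rcis_def algebra_simps)
  finally show "of_real (cmod z) * deriv_r f z = z * deriv h z + cnj (z * deriv g z)"
    by (simp only: z_eq)
qed

subsection \<open>Integrability of radial powers\<close>

lemma space_area_measure [simp]: "space area_measure = disk"
  by (simp add: area_measure_def space_scale_measure space_restrict_space)

lemma sets_area_measure: "A \<in> sets borel \<Longrightarrow> A \<subseteq> disk \<Longrightarrow> A \<in> sets area_measure"
  by (auto simp: area_measure_def sets_restrict_space_iff)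

lemma emeasure_area_measure_annulus:
  assumes "0 \<le> r" "r \<le> 1"
  shows "emeasure area_measure (disk - ball 0 r) = ennreal (1 - r\<^sup>2)"
proof -
  have b: "emeasure lborel (ball (0::complex) r) = ennreal (pi * r\<^sup>2)" if "0 \<le> r" for r
    using emeasure_ball[OF that, of "0::complex"] by (simp add: unit_ball_vol_2)
  have "emeasure area_measure (disk - ball 0 r) = ennreal (1 / pi) * emeasure lborel (disk - ball 0 r)"
    by (simp add: area_measure_def emeasure_restrict_space)
  also have "emeasure lborel (disk - ball 0 r) = emeasure lborel disk - emeasure lborel (ball (0::complex) r)"
    using assms by (intro emeasure_Diff) (auto simp: b)
  also have "\<dots> = ennreal (pi * (1 - r\<^sup>2))"
    using assms by (simp add: b ennreal_minus algebra_simps)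
  also have "ennreal (1 / pi) * \<dots> = ennreal (1 - r\<^sup>2)"
    using assms by (subst ennreal_mult[symmetric]) (auto simp: power_le_one)
  finally show ?thesis .
qed

text \<open>Dyadic decomposition: where \<open>1 - cmod z\<close> lies between
  \<open>(1/2) ^ Suc n\<close> and \<open>(1/2) ^ n\<close> the integrand is at most
  \<open>c n\<close>, and this shell lies in \<open>B n\<close>, whose measure is at most
  \<open>2 * (1/2) ^ n\<close>.\<close>

lemma nn_integral_one_minus_norm_powr_finite:
  fixes s C :: real
  assumes s: "s < 1" "0 \<le> s"
  shows "(\<integral>\<^sup>+ z. ennreal (C * (1 - cmod z) powr (- s)) \<partial>area_measure) < \<infinity>"
proof -
  define D where "D = max C 0"
  define B where "B n = disk - ball (0::complex) (1 - (1/2) ^ n)" for n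
  define c where "c n = D * ((1/2) ^ Suc n) powr (- s)" for n
  have D: "D \<ge> 0" by (simp add: D_def)
  have c: "c n \<ge> 0" for n by (simp add: c_def D)
  have sets: "B n \<in> sets area_measure" for n by (intro sets_area_measure) (auto simp: B_def)
  have term_le: "F n \<le> suminf F" for n and F :: "nat \<Rightarrow> ennreal"
    using sum_le_suminf[of F "{n}"] by simp
  have le: "ennreal (C * (1 - cmod z) powr (- s)) \<le> (\<Sum>n. ennreal (c n) * indicator (B n) z)"
    if z: "z \<in> disk" for z
  proof -
    \<comment> \<open>The index of the dyadic shell containing \<open>z\<close>. The upper bound
      \<open>n2\<close> comes from minimality, except for \<open>n = 0\<close>, where it reads
      \<open>1 - cmod z \<le> 1\<close>.\<close>
    define n where "n = (LEAST n. (1/2) ^ Suc n < 1 - cmod z)"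
    obtain k :: nat where k: "(1/2) ^ k < 1 - cmod z"
      using z real_arch_pow_inv[of "1 - cmod z" "1/2"] by auto
    have "(1/2) ^ Suc k \<le> (1/2 :: real) ^ k" by simp
    with k have "(1/2) ^ Suc k < 1 - cmod z" by linarith
    then have n1: "(1/2) ^ Suc n < 1 - cmod z" unfolding n_def by (rule LeastI)
    have n2: "1 - cmod z \<le> (1/2) ^ n"
    proof (cases n)
      case (Suc m)
      then have "\<not> (1/2) ^ Suc m < 1 - cmod z" 
        using not_less_Least[of m "\<lambda>n. (1/2) ^ Suc n < 1 - cmod z", folded n_def] by simp
      then show ?thesis using Suc by simp
    qed simp
    have "C * (1 - cmod z) powr (- s) \<le> D * (1 - cmod z) powr (- s)"
      by (intro mult_right_mono) (auto simp: D_def)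
    also have "\<dots> \<le> c n" unfolding c_def
      using n1 s by (intro mult_left_mono powr_mono2' D) auto
    finally have "ennreal (C * (1 - cmod z) powr (- s)) \<le> ennreal (c n) * indicator (B n) z"
      using z n2 by (simp add: B_def ennreal_leI)
    also have "\<dots> \<le> (\<Sum>n. ennreal (c n) * indicator (B n) z)"
      by (rule term_le)
    finally show ?thesis .
  qed
  \<comment> \<open>A geometric series of ratio \<open>2 powr (s - 1)\<close>; this is where
    \<open>s < 1\<close> enters.\<close>
  have summable: "summable (\<lambda>n. c n * (2 * (1/2) ^ n))"
  proof -
    have "c n * (2 * (1/2) ^ n) = D * 2 powr (s + 1) * (2 powr (s - 1)) ^ n" for n
      by (simp add: c_def powr_realpow[symmetric] powr_powr powr_divide powr_diff powr_add powr_minus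
            powr_power powr_mult field_simps)
    moreover have "summable (\<lambda>n. (2 powr (s - 1)) ^ n)"
      using s powr_less_mono[of "s - 1" 0 2] by (intro summable_geometric) simp
    ultimately show ?thesis by (simp add: summable_mult)
  qed
  have "(\<integral>\<^sup>+ z. ennreal (C * (1 - cmod z) powr (- s)) \<partial>area_measure)
      \<le> (\<integral>\<^sup>+ z. (\<Sum>n. ennreal (c n) * indicator (B n) z) \<partial>area_measure)"
    using le by (intro nn_integral_mono) auto
  also have "\<dots> = (\<Sum>n. ennreal (c n) * emeasure area_measure (B n))"
    using sets by (subst nn_integral_suminf) (auto intro!: suminf_cong nn_integral_cmult_indicator)
  also have "\<dots> \<le> (\<Sum>n. ennreal (c n * (2 * (1/2) ^ n)))"
  proof (intro suminf_le)
    fix n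
    have "emeasure area_measure (B n) = ennreal (1 - (1 - (1/2) ^ n)\<^sup>2)"
      unfolding B_def by (rule emeasure_area_measure_annulus) (auto simp: power_le_one)
    \<comment> \<open>With \<open>x = (1/2) ^ n\<close>,
      \<open>1 - (1 - x)\<^sup>2 = 2 * x - x\<^sup>2\<close>.\<close>
    also have "\<dots> \<le> ennreal (2 * (1/2) ^ n)"
      by (intro ennreal_leI) (simp add: power2_eq_square algebra_simps)
    finally show "ennreal (c n) * emeasure area_measure (B n) \<le> ennreal (c n * (2 * (1/2) ^ n))"
      using c[of n] by (simp add: ennreal_mult' mult_left_mono)
  qed auto
  also have "\<dots> = ennreal (\<Sum>n. c n * (2 * (1/2) ^ n))"
    using c summable by (intro suminf_ennreal2) auto
  finally show ?thesis by (simp add: le_less_trans)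
qed

lemma bergman_norm_finite_growth:
  fixes C b p :: real
  assumes p: "0 < p" "p * b < 1" and b: "0 \<le> b"
    and le: "\<And>z. z \<in> disk \<Longrightarrow> cmod (f z) \<le> C * (1 - cmod z) powr (- b)"
  shows "bergman_norm p f < \<infinity>"
proof -
  \<comment> \<open>At the origin the weight equals 1, so the assumed bound itself forces the sign
    of \<open>C\<close>.\<close>
  have C: "C \<ge> 0" using le[of 0] norm_ge_zero[of "f 0"] by (simp del: norm_ge_zero)
  have "(\<integral>\<^sup>+ z. ennreal (cmod (f z) powr p) \<partial>area_measure)
      \<le> (\<integral>\<^sup>+ z. ennreal (C powr p * (1 - cmod z) powr (- (p * b))) \<partial>area_measure)"
  proof (intro nn_integral_mono ennreal_leI)
    fix z assume "z \<in> space area_measure"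
    then have "cmod (f z) powr p \<le> (C * (1 - cmod z) powr (- b)) powr p"
      using le p by (intro powr_mono2) auto
    also have "\<dots> = C powr p * (1 - cmod z) powr (- (p * b))"
      using C by (simp add: powr_mult powr_powr mult.commute)
    finally show "cmod (f z) powr p \<le> C powr p * (1 - cmod z) powr (- (p * b))" .
  qed
  also have "\<dots> < \<infinity>"
    using p b by (intro nn_integral_one_minus_norm_powr_finite) auto
  finally show ?thesis by (auto simp: bergman_norm_def Let_def)
qed

subsection \<open>The Koebe transform\<close>

text \<open>\<open>Moebius_function 0 (- \<zeta>)\<close> is the disk automorphism taking 0 to
  \<open>\<zeta>\<close>. The factor \<open>c\<close> is left free because the part \<open>g\<close>
  has to be transformed with \<open>cnj c\<close>.\<close>

definition koebe_transform :: "complex \<Rightarrow> complex \<Rightarrow> (complex \<Rightarrow> complex) \<Rightarrow> complex \<Rightarrow> complex" where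
  "koebe_transform c \<zeta> f z = c * (f (Moebius_function 0 (- \<zeta>) z) - f \<zeta>)"

lemma one_plus_cnj_mult_nonzero:
  assumes "\<zeta> \<in> disk" "z \<in> disk"
  shows "1 + cnj \<zeta> * z \<noteq> 0"
proof -
  have "cmod (cnj \<zeta> * z) < 1"
    using assms mult_strict_mono'[of "cmod \<zeta>" 1 "cmod z" 1] by (simp add: norm_mult)
  then show ?thesis
    by (metis add_eq_0_iff norm_minus_cancel norm_one less_irrefl)
qed

lemma has_field_derivative_Moebius_function:
  assumes "\<zeta> \<in> disk" "z \<in> disk"
  shows "(Moebius_function 0 (- \<zeta>) has_field_derivative
           of_real (1 - (cmod \<zeta>)\<^sup>2) / (1 + cnj \<zeta> * z)\<^sup>2) (at z)"
proof -
  have nz: "1 + cnj \<zeta> * z \<noteq> 0" by (rule one_plus_cnj_mult_nonzero[OF assms])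
  have *: "((\<lambda>z. (z + \<zeta>) / (1 + cnj \<zeta> * z)) has_field_derivative
           of_real (1 - (cmod \<zeta>)\<^sup>2) / (1 + cnj \<zeta> * z)\<^sup>2) (at z)"
  proof -
    have "of_real (1 - (cmod \<zeta>)\<^sup>2) = 1 - \<zeta> * cnj \<zeta>"
      by (simp only: of_real_diff complex_norm_square of_real_1)
    moreover have "((\<lambda>z. (z + \<zeta>) / (1 + cnj \<zeta> * z)) has_field_derivative
        (1 * (1 + cnj \<zeta> * z) - (z + \<zeta>) * cnj \<zeta>) / ((1 + cnj \<zeta> * z) * (1 + cnj \<zeta> * z))) (at z)"
      by (intro DERIV_divide nz) (auto intro!: derivative_eq_intros)
    ultimately show ?thesis by (simp add: power2_eq_square algebra_simps)
  qed
  have "(\<lambda>z. (z + \<zeta>) / (1 + cnj \<zeta> * z)) = Moebius_function 0 (- \<zeta>)"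
    by (simp add: Moebius_function_simple fun_eq_iff)
  with * show ?thesis by simp
qed

lemma Moebius_function_in_disk: "\<zeta> \<in> disk \<Longrightarrow> z \<in> disk \<Longrightarrow> Moebius_function 0 (- \<zeta>) z \<in> disk"
  using Moebius_function_norm_lt_1[of "- \<zeta>" z 0] by simp

lemma koebe_transform_has_field_derivative:
  assumes h: "h holomorphic_on disk" and "\<zeta> \<in> disk" "z \<in> disk"
  shows "(koebe_transform c \<zeta> h has_field_derivative
      c * (deriv h (Moebius_function 0 (- \<zeta>) z) * (of_real (1 - (cmod \<zeta>)\<^sup>2) / (1 + cnj \<zeta> * z)\<^sup>2))) (at z)"
proof -
  have "(h has_field_derivative deriv h (Moebius_function 0 (- \<zeta>) z)) (at (Moebius_function 0 (- \<zeta>) z))"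
    using Moebius_function_in_disk assms by (intro holomorphic_derivI[OF h]) auto
  from DERIV_chain2[OF this has_field_derivative_Moebius_function[OF assms(2,3)]]
  show ?thesis unfolding koebe_transform_def
    by (auto intro!: derivative_eq_intros)
qed

lemma koebe_transform_holomorphic:
  assumes "h holomorphic_on disk" "\<zeta> \<in> disk"
  shows "koebe_transform c \<zeta> h holomorphic_on disk"
  unfolding holomorphic_on_open[OF open_ball]
  using koebe_transform_has_field_derivative[OF assms] by blast

text \<open>Writing M for the automorphism and r for \<open>1 - (cmod \<zeta>)\<^sup>2\<close>, the
  chain rule is evaluated with \<open>M' 0 = r\<close> and
  \<open>M'' 0 = - 2 * cnj \<zeta> * r\<close>.\<close>

lemma deriv_deriv_koebe_transform_0:
  assumes h: "h holomorphic_on disk" and \<zeta>: "\<zeta> \<in> disk"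
  shows "deriv (deriv (koebe_transform c \<zeta> h)) 0 =
     c * of_real (1 - (cmod \<zeta>)\<^sup>2) * (of_real (1 - (cmod \<zeta>)\<^sup>2) * deriv (deriv h) \<zeta> - 2 * cnj \<zeta> * deriv h \<zeta>)"
proof -
  let ?r = "of_real (1 - (cmod \<zeta>)\<^sup>2) :: complex" and ?M = "Moebius_function 0 (- \<zeta>)"
  have 0: "?M 0 = \<zeta>" by (simp add: Moebius_function_simple)
  have "(deriv h has_field_derivative deriv (deriv h) (?M 0)) (at (?M 0))"
    using \<zeta> unfolding 0 by (intro holomorphic_derivI[OF holomorphic_deriv[OF h]]) auto
  from DERIV_chain2[OF this has_field_derivative_Moebius_function[OF \<zeta>, of 0]]
  have "((\<lambda>z. deriv h (?M z)) has_field_derivative deriv (deriv h) \<zeta> * ?r) (at 0)"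
    by (simp add: 0)
  then have "((\<lambda>z. c * (deriv h (?M z) * (?r / (1 + cnj \<zeta> * z)\<^sup>2))) has_field_derivative
     c * ?r * (?r * deriv (deriv h) \<zeta> - 2 * cnj \<zeta> * deriv h \<zeta>)) (at 0)"
    by (auto intro!: derivative_eq_intros simp: 0 power2_eq_square algebra_simps)
  then have "(deriv (koebe_transform c \<zeta> h) has_field_derivative
     c * ?r * (?r * deriv (deriv h) \<zeta> - 2 * cnj \<zeta> * deriv h \<zeta>)) (at 0)"
    by (rule has_field_derivative_transform_within_open[of _ _ _ disk])
       (use DERIV_imp_deriv[OF koebe_transform_has_field_derivative[OF h \<zeta>]] in auto)
  then show ?thesis by (rule DERIV_imp_deriv)
qed

text \<open>This is positivity of the Jacobian. It has two uses: \<open>h'\<close> has no zeros, so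
  it can be divided by and has a logarithm, and every bound on \<open>h'\<close> passes to
  \<open>g'\<close>.\<close>

lemma S_HK_norm_deriv_less:
  assumes f: "f \<in> S_HK K" and rep: "canonical_rep f h g" and z: "z \<in> disk"
  shows "cmod (deriv g z) < cmod (deriv h z)"
proof -
  have "jacobian f z > 0"
    using f z by (auto simp: S_HK_def S_H_def sense_preserving_harmonic_def)
  then show ?thesis
    using deriv_z_canonical_rep[OF rep z] deriv_zbar_canonical_rep[OF rep z]
    by (simp add: jacobian_def power_mono_iff power2_less_imp_less)
qed

text \<open>Composing with a disk automorphism and an affine map multiplies the moduli of both
  Wirtinger derivatives by the same positive factor, so the sign of the Jacobian and the dilatation
  are preserved. The value of \<open>c\<close> makes the new analytic part have derivative 1 at
  0.\<close>

lemma koebe_transform_in_S_HK: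
  assumes f: "f \<in> S_HK K" and rep: "canonical_rep f h g" and \<zeta>: "\<zeta> \<in> disk"
    and c: "c = 1 / (of_real (1 - (cmod \<zeta>)\<^sup>2) * deriv h \<zeta>)"
  shows "koebe_transform c \<zeta> f \<in> S_HK K"
    and "canonical_rep (koebe_transform c \<zeta> f) (koebe_transform c \<zeta> h) (koebe_transform (cnj c) \<zeta> g)"
proof -
  let ?F = "koebe_transform c \<zeta> f" and ?H = "koebe_transform c \<zeta> h" 
    and ?G = "koebe_transform (cnj c) \<zeta> g" and ?M = "Moebius_function 0 (- \<zeta>)"
  note hg = canonical_rep_holomorphic[OF rep]
  have M: "?M z \<in> disk" if "z \<in> disk" for z using Moebius_function_in_disk[OF \<zeta> that] .
  have 0: "?M 0 = \<zeta>" by (simp add: Moebius_function_simple)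
  have r: "1 - (cmod \<zeta>)\<^sup>2 > 0" using \<zeta> by (simp add: abs_square_less_1)
  then have r': "of_real (1 - (cmod \<zeta>)\<^sup>2) \<noteq> (0::complex)" by (metis of_real_eq_0_iff less_irrefl)
  have h': "deriv h \<zeta> \<noteq> 0" using S_HK_norm_deriv_less[OF f rep \<zeta>] by auto
  have c0: "c \<noteq> 0" using r' h' c by simp
  show rep': "canonical_rep ?F ?H ?G"
    using koebe_transform_holomorphic[OF hg(1) \<zeta>] koebe_transform_holomorphic[OF hg(2) \<zeta>] hg(3)[OF M] hg(3)[OF \<zeta>]
    by (auto simp: canonical_rep_def analytic_on_open koebe_transform_def 0 algebra_simps)
  note hg' = canonical_rep_holomorphic[OF rep']
  have deriv_H: "deriv ?H z = c * (deriv h (?M z) * (of_real (1 - (cmod \<zeta>)\<^sup>2) / (1 + cnj \<zeta> * z)\<^sup>2))"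
    and deriv_G: "deriv ?G z = cnj c * (deriv g (?M z) * (of_real (1 - (cmod \<zeta>)\<^sup>2) / (1 + cnj \<zeta> * z)\<^sup>2))"
    if "z \<in> disk" for z
    using koebe_transform_has_field_derivative[OF hg(1) \<zeta> that] koebe_transform_has_field_derivative[OF hg(2) \<zeta> that]
    by (auto intro: DERIV_imp_deriv)
  \<comment> \<open>The common factor: \<open>cmod c\<close> times the modulus of the derivative of
    \<open>?M\<close> at \<open>z\<close>.\<close>
  define m where "m z = cmod c * ((1 - (cmod \<zeta>)\<^sup>2) / (cmod (1 + cnj \<zeta> * z))\<^sup>2)" for z
  have m: "m z > 0" if "z \<in> disk" for z
    using r c0 one_plus_cnj_mult_nonzero[OF \<zeta> that] by (auto simp: m_def)
  have norm_z: "cmod (deriv_z ?F z) = m z * cmod (deriv_z f (?M z))"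
    and norm_zbar: "cmod (deriv_zbar ?F z) = m z * cmod (deriv_zbar f (?M z))" if z: "z \<in> disk" for z
  proof -
    have "cmod (of_real (1 - (cmod \<zeta>)\<^sup>2)) = 1 - (cmod \<zeta>)\<^sup>2"
      using r by (simp only: norm_of_real abs_of_pos)
    then have "cmod (deriv ?H z) = m z * cmod (deriv h (?M z))" "cmod (deriv ?G z) = m z * cmod (deriv g (?M z))"
      unfolding deriv_H[OF z] deriv_G[OF z] m_def norm_mult norm_divide norm_power complex_mod_cnj
      by simp_all
    then show "cmod (deriv_z ?F z) = m z * cmod (deriv_z f (?M z))"
      "cmod (deriv_zbar ?F z) = m z * cmod (deriv_zbar f (?M z))"
      by (simp_all only: deriv_z_canonical_rep[OF rep' z] deriv_zbar_canonical_rep[OF rep' z]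
        deriv_z_canonical_rep[OF rep M[OF z]] deriv_zbar_canonical_rep[OF rep M[OF z]] complex_mod_cnj)
  qed
  have qr: "harmonic_quasiregular K f" and inj: "inj_on f disk"
    using f by (auto simp: S_HK_def S_H_def harmonic_quasiconformal_def)
  have jac: "jacobian ?F z = (m z)\<^sup>2 * jacobian f (?M z)" if "z \<in> disk" for z
    using that by (simp add: jacobian_def norm_z norm_zbar power_mult_distrib algebra_simps)
  have dil: "dilatation ?F z = dilatation f (?M z)" if "z \<in> disk" for z
    using m[OF that] that
    by (simp add: dilatation_def norm_z norm_zbar distrib_left[symmetric] right_diff_distrib[symmetric])
  have harm: "harmonic_on disk ?F"
    by (rule harmonic_on_add_cnj[OF open_ball hg'(1,2)]) (rule hg'(3))
  have sp: "sense_preserving_harmonic ?F"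
    unfolding sense_preserving_harmonic_def
  proof (intro conjI ballI harm)
    fix z assume z: "z \<in> disk"
    show "jacobian ?F z > 0"
      unfolding jac[OF z] using qr m[OF z] M[OF z]
      by (intro mult_pos_pos) (auto simp: harmonic_quasiregular_def sense_preserving_harmonic_def)
  qed
  have qr': "harmonic_quasiregular K ?F"
    using qr sp M by (auto simp: harmonic_quasiregular_def dil)
  have inj': "inj_on ?F disk"
  proof (rule inj_onI)
    fix z w assume zw: "z \<in> disk" "w \<in> disk" "?F z = ?F w"
    then have "?M z = ?M w"
      using c0 inj M by (auto simp: koebe_transform_def dest: inj_onD)
    \<comment> \<open>\<open>Moebius_function 0 \<zeta>\<close> inverts \<open>?M\<close> on the
      disk.\<close>
    then have "Moebius_function 0 \<zeta> (?M z) = Moebius_function 0 \<zeta> (?M w)" by simp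
    then show "z = w" using zw \<zeta> Moebius_function_compose[of \<zeta> "- \<zeta>"] by simp
  qed
  \<comment> \<open>Invariance of domain: a continuous injection of an open set is a homeomorphism
    onto its image.\<close>
  obtain F' where "homeomorphism disk (?F ` disk) ?F F'"
    by (rule invariance_of_domain_homeomorphism[OF open_ball hg'(4) _ inj']) auto
  moreover have "?H 0 = 0" "?G 0 = 0" "deriv ?H 0 = 1"
    using deriv_H[of 0] r' h' by (simp_all add: koebe_transform_def 0 c del: of_real_diff of_real_power)
  ultimately show "?F \<in> S_HK K"
    using sp qr' inj' rep' by (auto simp: S_HK_def S_H_def harmonic_quasiconformal_def)
qed

text \<open>The transform centred at \<open>z\<close> competes in the supremum defining the order,
  which bounds its second coefficient by \<open>b\<close>; the triangle inequality then removes
  \<open>2 * cnj z\<close>. Allowing \<open>b\<close> above the order gives room for the case of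
  order 0.\<close>

lemma S_HK_pre_Schwarzian_bound:
  assumes f: "f \<in> S_HK K" and rep: "canonical_rep f h g" and z: "z \<in> disk"
    and b: "order_HK K \<le> ereal b"
  shows "cmod (deriv (deriv h) z / deriv h z) \<le> 2 * (b + cmod z) / (1 - (cmod z)\<^sup>2)"
proof -
  let ?r = "of_real (1 - (cmod z)\<^sup>2) :: complex"
  define c where "c = 1 / (?r * deriv h z)"
  have r: "1 - (cmod z)\<^sup>2 > 0" using z by (simp add: abs_square_less_1)
  then have r': "?r \<noteq> 0" by (metis of_real_eq_0_iff less_irrefl)
  have h': "deriv h z \<noteq> 0" using S_HK_norm_deriv_less[OF f rep z] by auto
  have "deriv (deriv (koebe_transform c z h)) 0 = ?r * (deriv (deriv h) z / deriv h z) - 2 * cnj z"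
    using deriv_deriv_koebe_transform_0[OF canonical_rep_holomorphic(1)[OF rep] z, of c] r' h'
    by (simp add: c_def field_simps del: of_real_diff of_real_power)
  moreover have "ereal (cmod (deriv (deriv (koebe_transform c z h)) 0 / 2)) \<le> order_HK K"
    unfolding order_HK_def using koebe_transform_in_S_HK[OF f rep z c_def]
    by (intro Sup_upper) blast
  then have "cmod (deriv (deriv (koebe_transform c z h)) 0 / 2) \<le> b"
    using b by (meson order_trans ereal_less_eq(3))
  ultimately have *: "cmod (?r * (deriv (deriv h) z / deriv h z) - 2 * cnj z) \<le> 2 * b"
    by (simp add: norm_divide)
  have "(1 - (cmod z)\<^sup>2) * cmod (deriv (deriv h) z / deriv h z) = cmod (?r * (deriv (deriv h) z / deriv h z))"
    using r by (simp only: norm_mult norm_of_real abs_of_pos)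
  also have "\<dots> \<le> cmod (?r * (deriv (deriv h) z / deriv h z) - 2 * cnj z) + cmod (2 * cnj z)"
    by (metis norm_triangle_sub add.commute)
  also have "\<dots> \<le> 2 * (b + cmod z)" using * by (simp add: norm_mult)
  finally show ?thesis using r by (simp add: field_simps)
qed

subsection \<open>Growth estimates\<close>

text \<open>The zero-free function \<open>h'\<close> has a holomorphic logarithm \<open>w\<close> on
  the disk, and \<open>w' = h'' / h'\<close>; the pre-Schwarzian bound is therefore a bound on
  \<open>w'\<close>, to be integrated along the radius to \<open>z\<close>.\<close>

lemma S_HK_norm_deriv_growth:
  assumes f: "f \<in> S_HK K" and rep: "canonical_rep f h g" and h0: "deriv h 0 = 1"
    and z: "z \<in> disk" and b: "order_HK K \<le> ereal b" "0 \<le> b"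
  shows "cmod (deriv h z) \<le> 2 powr b * (1 - cmod z) powr (- (b + 1))"
proof -
  have h: "h holomorphic_on disk" using canonical_rep_holomorphic[OF rep] by simp
  have h': "deriv h holomorphic_on disk" using h by (intro holomorphic_deriv) auto
  have nz: "deriv h w \<noteq> 0" if "w \<in> disk" for w using S_HK_norm_deriv_less[OF f rep that] by auto
  obtain w where w: "w holomorphic_on disk" "\<And>x. x \<in> disk \<Longrightarrow> exp (w x) = deriv h x"
    using holomorphic_logarithm_exists[OF convex_ball open_ball h' nz, of 0] by auto
  define r where "r = cmod z"
  \<comment> \<open>At \<open>z = 0\<close> this is 0, hence only \<open>cmod u \<le> 1\<close> is
    claimed and the origin is included.\<close>
  define u where "u = sgn z"
  have r: "0 \<le> r" "r < 1" using z by (auto simp: r_def)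
  have zu: "z = of_real r * u" by (simp add: r_def u_def sgn_eq)
  have u: "cmod u \<le> 1" by (simp add: u_def norm_sgn)
  have tu: "of_real t * u \<in> disk" "cmod (of_real t * u) \<le> t" if "0 \<le> t" "t < 1" for t
    using that u mult_left_mono[OF u, of t] by (auto simp: norm_mult)
  have w': "deriv w x = deriv (deriv h) x / deriv h x" if x: "x \<in> disk" for x
  proof -
    have "((\<lambda>x. exp (w x)) has_field_derivative exp (w x) * deriv w x) (at x)"
      using holomorphic_derivI[OF w(1) open_ball x, of UNIV] by (auto intro!: derivative_eq_intros)
    then have "(deriv h has_field_derivative exp (w x) * deriv w x) (at x)"
      by (rule has_field_derivative_transform_within_open[of _ _ _ disk]) (use x w in auto)
    then have "deriv (deriv h) x = deriv h x * deriv w x"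
      using w(2)[OF x] by (simp add: DERIV_imp_deriv)
    then show ?thesis using nz[OF x] by simp
  qed
  \<comment> \<open>the logarithm of \<open>\<bar>h'(t u)\<bar>\<close> over its extremal majorant \<open>(1 + t)\<^sup>b\<^sup>-\<^sup>1 / (1 - t)\<^sup>b\<^sup>+\<^sup>1\<close>\<close>
  define L where "L t = Re (w (of_real t * u)) + (b + 1) * ln (1 - t) - (b - 1) * ln (1 + t)" for t
  have "L r \<le> L 0"
  proof (rule DERIV_nonpos_imp_nonincreasing[OF r(1)])
    fix t assume t: "0 \<le> t" "t \<le> r"
    let ?x = "of_real t * u"
    have x: "?x \<in> disk" "cmod ?x \<le> t" using tu[of t] t r by auto
    have "((\<lambda>t. of_real t * u) has_vector_derivative u) (at t)"
      by (auto intro!: derivative_eq_intros simp: has_vector_derivative_def scaleR_conv_of_real)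
    from field_vector_diff_chain_at[OF this holomorphic_derivI[OF w(1) open_ball x(1), of UNIV]]
    have "((\<lambda>t. w (of_real t * u)) has_vector_derivative u * deriv w ?x) (at t)" by (simp add: o_def)
    then have "((\<lambda>t. Re (w (of_real t * u))) has_real_derivative Re (u * deriv w ?x)) (at t)"
      by (simp add: has_vector_derivative_complex_iff)
    moreover have "((\<lambda>t. (b + 1) * ln (1 - t)) has_real_derivative - ((b + 1) / (1 - t))) (at t)"
      "((\<lambda>t. (b - 1) * ln (1 + t)) has_real_derivative (b - 1) / (1 + t)) (at t)"
      using t r by (auto intro!: derivative_eq_intros)
    ultimately have "(L has_real_derivative
        (Re (u * deriv w ?x) + - ((b + 1) / (1 - t)) - (b - 1) / (1 + t))) (at t)"
      unfolding L_def by (intro DERIV_diff DERIV_add)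
    moreover have "Re (u * deriv w ?x) + - ((b + 1) / (1 - t)) - (b - 1) / (1 + t) \<le> 0"
    proof -
      have "Re (u * deriv w ?x) \<le> cmod (u * deriv w ?x)" by (rule complex_Re_le_cmod)
      also have "\<dots> \<le> 1 * cmod (deriv w ?x)"
        unfolding norm_mult by (intro mult_right_mono u) auto
      also have "\<dots> \<le> 2 * (b + cmod ?x) / (1 - (cmod ?x)\<^sup>2)"
        using S_HK_pre_Schwarzian_bound[OF f rep x(1) b(1)] w'[OF x(1)] by simp
      also have "\<dots> \<le> 2 * (b + t) / (1 - t\<^sup>2)"
        using x(2) b t r by (intro frac_le) (auto simp: abs_square_less_1 power_mono)
      \<comment> \<open>Partial fractions; these terms cancel the derivatives of the two logarithms
        in \<open>L\<close>.\<close>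
      also have "\<dots> = (b + 1) / (1 - t) + (b - 1) / (1 + t)"
      proof -
        have "1 - t\<^sup>2 = (1 - t) * (1 + t)" by (simp add: power2_eq_square algebra_simps)
        then show ?thesis using t r by (simp add: divide_simps) (simp add: algebra_simps)
      qed
      finally show ?thesis by simp
    qed
    ultimately show "\<exists>y. (L has_real_derivative y) (at t) \<and> y \<le> 0" by blast
  qed
  \<comment> \<open>The normalization fixes \<open>w 0\<close> only up to a multiple of
    \<open>2 * pi * \<i>\<close>, but its real part is determined, and so
    \<open>L 0 = 0\<close>.\<close>
  moreover have "Re (w 0) = 0"
  proof -
    have "exp (Re (w 0)) = cmod (deriv h 0)" using w(2)[of 0] by (simp flip: norm_exp_eq_Re)
    then show ?thesis using h0 by simp
  qed
  ultimately have Re_w: "Re (w z) \<le> (b - 1) * ln (1 + r) + - (b + 1) * ln (1 - r)"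
    by (simp add: L_def zu[symmetric]) (simp add: algebra_simps)
  have "cmod (deriv h z) = exp (Re (w z))"
    using w(2)[OF z] by (simp flip: norm_exp_eq_Re)
  also have "\<dots> \<le> exp ((b - 1) * ln (1 + r) + - (b + 1) * ln (1 - r))" using Re_w by simp
  also have "\<dots> = (1 + r) powr (b - 1) * (1 - r) powr (- (b + 1))"
    using r by (simp add: powr_def exp_add)
  also have "\<dots> \<le> 2 powr b * (1 - r) powr (- (b + 1))"
  proof (rule mult_right_mono)
    \<comment> \<open>The exponent \<open>b - 1\<close> may be negative, so it is raised to
      \<open>b\<close> before the base is raised to 2.\<close>
    have "(1 + r) powr (b - 1) \<le> (1 + r) powr b" using r by (intro powr_mono) auto
    also have "\<dots> \<le> 2 powr b" using r b by (intro powr_mono2) auto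
    finally show "(1 + r) powr (b - 1) \<le> 2 powr b" .
  qed simp
  finally show ?thesis by (simp add: r_def)
qed

text \<open>On the radius to \<open>z\<close> the assumed bound is the derivative of
  \<open>C / b * (1 - t) powr (- b)\<close>. This primitive requires \<open>b\<close> to be nonzero;
  the exponent -1 would produce a logarithm.\<close>

lemma holomorphic_growth_from_deriv_growth:
  fixes C b :: real
  assumes h: "h holomorphic_on disk" and h0: "h 0 = 0" and b: "0 < b"
    and le: "\<And>z. z \<in> disk \<Longrightarrow> cmod (deriv h z) \<le> C * (1 - cmod z) powr (- (b + 1))"
    and z: "z \<in> disk"
  shows "cmod (h z) \<le> C / b * (1 - cmod z) powr (- b)"
proof -
  have C: "0 \<le> C" using le[of 0] norm_ge_zero[of "deriv h 0"] by (simp del: norm_ge_zero)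
  show ?thesis
  \<comment> \<open>The mean value estimate below is applied on a nondegenerate interval, and the
    direction \<open>u\<close> must have modulus 1.\<close>
  proof (cases "z = 0")
    case True
    then show ?thesis using C b h0 by simp
  next
    case False
    define r where "r = cmod z"
    define u where "u = sgn z"
    have r: "0 < r" "r < 1" using z False by (auto simp: r_def)
    have zu: "z = of_real r * u" by (simp add: r_def u_def sgn_eq)
    have u: "cmod u = 1" using False by (simp add: u_def norm_sgn)
    have tu: "of_real t * u \<in> disk" "cmod (of_real t * u) = t" if "0 \<le> t" "t < 1" for t
      using that u by (auto simp: norm_mult)
    have d: "((\<lambda>t. h (of_real t * u)) has_vector_derivative u * deriv h (of_real t * u)) (at t)"
      if "0 \<le> t" "t < 1" for t
    proof -
      have "((\<lambda>t. of_real t * u) has_vector_derivative u) (at t)"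
        by (auto intro!: derivative_eq_intros simp: has_vector_derivative_def scaleR_conv_of_real)
      from field_vector_diff_chain_at[OF this holomorphic_derivI[OF h open_ball tu(1)[OF that], of UNIV]]
      show ?thesis by (simp add: o_def)
    qed
    have p: "((\<lambda>t. C / b * (1 - t) powr (- b)) has_vector_derivative C * (1 - t) powr (- (b + 1))) (at t)"
      if "0 \<le> t" "t < 1" for t
    proof -
      have "((\<lambda>t. C / b * (1 - t) powr (- b)) has_real_derivative C * (1 - t) powr (- (b + 1))) (at t)"
        using that b by (auto intro!: derivative_eq_intros simp: powr_diff powr_minus powr_add field_simps)
      then show ?thesis by (simp add: has_real_derivative_iff_has_vector_derivative)
    qed
    have "cmod (h (of_real r * u) - h (of_real 0 * u)) \<le> C / b * (1 - r) powr (- b) - C / b * (1 - 0) powr (- b)"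
    proof (rule differentiable_bound_general[OF r(1)])
      show "continuous_on {0..r} (\<lambda>t. h (of_real t * u))" "continuous_on {0..r} (\<lambda>t. C / b * (1 - t) powr (- b))"
        using has_vector_derivative_continuous[OF d] has_vector_derivative_continuous[OF p] r
        by (intro continuous_at_imp_continuous_on ballI; simp)+
      fix t assume t: "0 < t" "t < r"
      then have t1: "0 \<le> t" "t < 1" using r by auto
      show "((\<lambda>t. h (of_real t * u)) has_vector_derivative u * deriv h (of_real t * u)) (at t)"
        by (rule d[OF t1])
      show "((\<lambda>t. C / b * (1 - t) powr (- b)) has_vector_derivative C * (1 - t) powr (- (b + 1))) (at t)"
        by (rule p[OF t1])
      show "cmod (u * deriv h (of_real t * u)) \<le> C * (1 - t) powr (- (b + 1))"
        using le[OF tu(1)[OF t1]] tu(2)[OF t1] u by (simp add: norm_mult)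
    qed
    then have "cmod (h z) \<le> C / b * (1 - r) powr (- b) - C / b"
      using zu h0 by simp
    also have "\<dots> \<le> C / b * (1 - r) powr (- b)" using C b by simp
    finally show ?thesis by (simp add: r_def)
  qed
qed

section \<open>From growth to membership in the Bergman spaces\<close>

theorem theorem3:
  fixes K :: real and f :: "complex \<Rightarrow> complex"
  assumes "K \<ge> 1"
    and "f \<in> S_HK K"
  shows "(\<forall>p::real. 0 < p \<and> ereal p < 1 / order_HK K \<longrightarrow> f \<in> harmonic_bergman p) \<and>
         (\<forall>q::real. 0 < q \<and> ereal q < 1 / (order_HK K + 1) \<longrightarrow>
            deriv_z f \<in> bergman q \<and>
            (\<lambda>z. cnj (deriv_zbar f z)) \<in> bergman q \<and>
            deriv_theta f \<in> harmonic_bergman q \<and>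
            (\<lambda>z. of_real (cmod z) * deriv_r f z) \<in> harmonic_bergman q)"
proof -
  obtain h g where rep: "canonical_rep f h g" and norm: "h 0 = 0" "g 0 = 0" "deriv h 0 = 1"
    using assms(2) by (auto simp: S_HK_def S_H_def)
  note f = assms(2)
  note hol = canonical_rep_holomorphic(1,2)[OF rep]
  have hol': "deriv h holomorphic_on disk" "deriv g holomorphic_on disk"
    using hol by (auto intro: holomorphic_deriv)
  \<comment> \<open>The coefficient of \<open>f\<close> itself belongs to the set, so the supremum
    is not the value \<open>-\<infinity>\<close> of an empty one.\<close>
  have "0 \<le> ereal (cmod (deriv (deriv h) 0 / 2))" by simp
  also have "\<dots> \<le> order_HK K" unfolding order_HK_def using f rep by (intro Sup_upper) blast
  finally have order_nonneg: "0 \<le> order_HK K" .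
  have growth: "cmod (deriv h z) \<le> 2 powr b * (1 - cmod z) powr (- (b + 1))"
    "cmod (deriv g z) \<le> 2 powr b * (1 - cmod z) powr (- (b + 1))"
    if "order_HK K \<le> ereal b" "0 \<le> b" "z \<in> disk" for b z
    using S_HK_norm_deriv_growth[OF f rep norm(3) that(3,1,2)] S_HK_norm_deriv_less[OF f rep that(3)] by simp_all
  have "f \<in> harmonic_bergman p" if p: "0 < p" "ereal p < 1 / order_HK K" for p
  proof -
    \<comment> \<open>A strictly positive \<open>b\<close> is needed to integrate \<open>h'\<close>
      and \<open>g'\<close>. An infinite order would give \<open>1 / order_HK K = 0\<close>,
      contradicting \<open>0 < p\<close>.\<close>
    obtain b where b: "order_HK K \<le> ereal b" "0 < b" "p * b < 1"
    proof (cases "order_HK K")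
      case (real a)
      show ?thesis
      proof (cases "a = 0")
        case True
        \<comment> \<open>here \<open>1 / order_HK K = \<infinity>\<close>, so \<open>p\<close> is arbitrary\<close>
        then show ?thesis using that[of "1 / (2 * p)"] p real by simp
      next
        case False
        with real order_nonneg have "a > 0" by simp
        then show ?thesis using that[of a] p real by (simp add: field_simps one_ereal_def)
      qed
    qed (use p order_nonneg in auto)
    have "cmod (f z) \<le> 2 * (2 powr b / b) * (1 - cmod z) powr (- b)" if z: "z \<in> disk" for z
    proof -
      have "cmod (h z) \<le> 2 powr b / b * (1 - cmod z) powr (- b)"
        "cmod (g z) \<le> 2 powr b / b * (1 - cmod z) powr (- b)"
        using growth[OF b(1)] b(2) norm z hol
        by (intro holomorphic_growth_from_deriv_growth; simp)+
      then have "cmod (h z) + cmod (cnj (g z)) \<le> 2 * (2 powr b / b) * (1 - cmod z) powr (- b)" by simp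
      then show ?thesis
        using norm_triangle_ineq[of "h z" "cnj (g z)"] canonical_rep_holomorphic(3)[OF rep z] by simp
    qed
    then have "bergman_norm p f < \<infinity>"
      using bergman_norm_finite_growth[of p b f "2 * (2 powr b / b)"] p b by simp
    then show ?thesis
      using f by (simp add: harmonic_bergman_def S_HK_def S_H_def sense_preserving_harmonic_def)
  qed
  moreover have "deriv_z f \<in> bergman q \<and> (\<lambda>z. cnj (deriv_zbar f z)) \<in> bergman q \<and>
      deriv_theta f \<in> harmonic_bergman q \<and> (\<lambda>z. of_real (cmod z) * deriv_r f z) \<in> harmonic_bergman q"
    if q: "0 < q" "ereal q < 1 / (order_HK K + 1)" for q
  proof -
    \<comment> \<open>Only derivatives are estimated here, so \<open>b = 0\<close> is harmless and
      the order itself serves.\<close>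
    obtain b where b: "order_HK K \<le> ereal b" "0 \<le> b" "q * (b + 1) < 1"
    proof (cases "order_HK K")
      case (real a)
      with order_nonneg have "a \<ge> 0" by simp
      then show ?thesis using that[of a] q real by (simp add: field_simps one_ereal_def)
    qed (use q order_nonneg in auto)
    have finite: "bergman_norm q F < \<infinity>"
      if "\<And>z. z \<in> disk \<Longrightarrow> cmod (F z) \<le> cmod (deriv h z) + cmod (deriv g z)" for F
    proof (rule bergman_norm_finite_growth)
      show "cmod (F z) \<le> 2 * 2 powr b * (1 - cmod z) powr (- (b + 1))" if z: "z \<in> disk" for z
        using growth[OF b(1,2) z] \<open>\<And>z. z \<in> disk \<Longrightarrow> cmod (F z) \<le> _\<close>[OF z] by simp
    qed (use q b in auto)
    \<comment> \<open>One form for both polar derivatives: \<open>a = \<i>\<close> gives the angular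
      one and \<open>a = 1\<close> the radial one times \<open>cmod z\<close>.\<close>
    have finite': "bergman_norm q F < \<infinity>"
      if F: "\<And>z. z \<in> disk \<Longrightarrow> F z = a * z * deriv h z + cnj (a * z * deriv g z)" and a: "cmod a = 1" for F a
    proof (rule finite)
      fix z assume z: "z \<in> disk"
      have "cmod (F z) \<le> cmod (a * z * deriv h z) + cmod (cnj (a * z * deriv g z))"
        unfolding F[OF z] by (rule norm_triangle_ineq)
      also have "\<dots> = cmod z * cmod (deriv h z) + cmod z * cmod (deriv g z)"
        using a by (simp add: norm_mult)
      also have "\<dots> \<le> 1 * cmod (deriv h z) + 1 * cmod (deriv g z)"
        using z by (intro add_mono mult_right_mono) auto
      finally show "cmod (F z) \<le> cmod (deriv h z) + cmod (deriv g z)" by simp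
    qed
    have harm: "harmonic_on disk F"
      if F: "\<And>z. z \<in> disk \<Longrightarrow> F z = a * z * deriv h z + cnj (a * z * deriv g z)" for F a
      by (rule harmonic_on_add_cnj[OF open_ball _ _ F]) (intro holomorphic_intros hol')+
    have "deriv_z f analytic_on disk" "(\<lambda>z. cnj (deriv_zbar f z)) analytic_on disk"
      unfolding analytic_on_open[OF open_ball]
      by (rule holomorphic_transform[OF hol'(1)]; simp add: deriv_z_canonical_rep[OF rep])
         (rule holomorphic_transform[OF hol'(2)]; simp add: deriv_zbar_canonical_rep[OF rep])
    moreover have "bergman_norm q (deriv_z f) < \<infinity>" "bergman_norm q (\<lambda>z. cnj (deriv_zbar f z)) < \<infinity>"
      by (rule finite; simp add: deriv_z_canonical_rep[OF rep] deriv_zbar_canonical_rep[OF rep])+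
    moreover note theta = deriv_theta_canonical_rep[OF rep]
      and r = norm_mult_deriv_r_canonical_rep[OF rep]
    have "deriv_theta f \<in> harmonic_bergman q"
      using harm[OF theta] finite'[OF theta] by (simp add: harmonic_bergman_def)
    moreover have "(\<lambda>z. of_real (cmod z) * deriv_r f z) \<in> harmonic_bergman q"
      using harm[of _ 1] finite'[of _ 1] r by (simp add: harmonic_bergman_def)
    ultimately show ?thesis by (simp add: bergman_def)
  qed
  ultimately show ?thesis by blast
qed

end
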